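(* If $X$ is a residually finite quandle, then $\operatorname{Inn}(X)$ is a residually finite group.
   Context: A quandle is a non-empty set $X$ with a binary operation $*$ such that: (1) $x*x=x$ for all $x\in X$; (2) for all $x,y\in X$ there is a unique $z\in X$ with $x=z*y$; (3) $(x*y)*z=(x*z)*(y*z)$ for all $x,y,z\in X$. A quandle homomorphism is a map $f$ with $f(x*y)=f(x)*f(y)$. A quandle $X$ is residually finite if for all $x,y\in X$ with $x\neq y$ there exist a finite quandle $F$ and a quandle homomorphism $\phi:X\to F$ with $\phi(x)\neq\phi(y)$. For $x\in X$, the map $S_x:X\to X$, $S_x(y)=y*x$, is an automorphism of the quandle $X$; $\operatorname{Inn}(X)$ is the group (under composition) generated by all $S_x$, $x\in X$. A group $G$ is residually finite if for each $g\in G$, $g\ne1$, there are a finite group $F$ and a group homomorphism $\phi:G\to F$ with $\phi(g)\neq 1$. *)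

theory Defs
  imports "HOL-Algebra.Generated_Groups" "HOL-Algebra.Bij"
begin

record 'a quandle = "'a partial_object" +
  quandle_op :: "'a \<Rightarrow> 'a \<Rightarrow> 'a" (infixl \<open>\<triangleright>\<index>\<close> 70)

locale quandle =
  fixes X (structure)
  assumes nonempty: "carrier X \<noteq> {}"
    and closed: "x \<in> carrier X \<Longrightarrow> y \<in> carrier X \<Longrightarrow> x \<triangleright> y \<in> carrier X"
    and idem: "x \<in> carrier X \<Longrightarrow> x \<triangleright> x = x"
    and right_div: "x \<in> carrier X \<Longrightarrow> y \<in> carrier X \<Longrightarrow> \<exists>!z. z \<in> carrier X \<and> x = z \<triangleright> y"
    and self_distrib: "x \<in> carrier X \<Longrightarrow> y \<in> carrier X \<Longrightarrow> z \<in> carrier X \<Longrightarrow>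
      (x \<triangleright> y) \<triangleright> z = (x \<triangleright> z) \<triangleright> (y \<triangleright> z)"

definition quandle_hom :: "('a, 'c) quandle_scheme \<Rightarrow> ('b, 'd) quandle_scheme \<Rightarrow> ('a \<Rightarrow> 'b) set"
  where "quandle_hom X Y = {f. f \<in> carrier X \<rightarrow> carrier Y \<and>
    (\<forall>x\<in>carrier X. \<forall>y\<in>carrier X. f (x \<triangleright>\<^bsub>X\<^esub> y) = f x \<triangleright>\<^bsub>Y\<^esub> f y)}"

text \<open>A definition in HOL cannot quantify over the types of the finite targets. The targets
  are therefore taken with carrier in \<^typ>\<open>nat\<close>, which loses no generality because every finite
  structure is isomorphic to one of these; see \<open>quandle_separating_nat\<close> and \<open>group_separating_nat\<close> below.\<close>

locale residually_finite_quandle = quandle +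
  assumes separating: "x \<in> carrier X \<Longrightarrow> y \<in> carrier X \<Longrightarrow> x \<noteq> y \<Longrightarrow>
    \<exists>(F :: nat quandle) \<phi>. quandle F \<and> finite (carrier F) \<and> \<phi> \<in> quandle_hom X F \<and> \<phi> x \<noteq> \<phi> y"

locale residually_finite_group = group +
  assumes separating: "g \<in> carrier G \<Longrightarrow> g \<noteq> \<one> \<Longrightarrow>
    \<exists>(F :: nat monoid) \<phi>. group F \<and> finite (carrier F) \<and> \<phi> \<in> hom G F \<and> \<phi> g \<noteq> \<one>\<^bsub>F\<^esub>"

definition inner_map :: "('a, 'b) quandle_scheme \<Rightarrow> 'a \<Rightarrow> 'a \<Rightarrow> 'a"
  where "inner_map X x = (\<lambda>y\<in>carrier X. y \<triangleright>\<^bsub>X\<^esub> x)"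

definition Inn :: "('a, 'b) quandle_scheme \<Rightarrow> ('a \<Rightarrow> 'a) monoid"
  where "Inn X = subgroup_generated (BijGroup (carrier X)) (inner_map X ` carrier X)"

text \<open>\<^const>\<open>subgroup_generated\<close> discards generators outside the ambient group. Here there are none.\<close>

lemma (in quandle) inner_map_Bij:
  assumes x: "x \<in> carrier X"
  shows "inner_map X x \<in> carrier (BijGroup (carrier X))"
proof -
  have "bij_betw (\<lambda>y. y \<triangleright> x) (carrier X) (carrier X)"
    unfolding bij_betw_def inj_on_def
  proof (intro conjI ballI impI equalityI subsetI)
    fix a b assume "a \<in> carrier X" "b \<in> carrier X" "a \<triangleright> x = b \<triangleright> x"
    moreover have "a \<triangleright> x \<in> carrier X" using closed calculation x by blast
    ultimately show "a = b" using right_div[of "a \<triangleright> x" x] x by metis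
  next
    fix a assume "a \<in> (\<lambda>y. y \<triangleright> x) ` carrier X"
    then show "a \<in> carrier X" using closed x by auto
  next
    fix a assume "a \<in> carrier X"
    then show "a \<in> (\<lambda>y. y \<triangleright> x) ` carrier X" using right_div[of a x] x by blast
  qed
  then have "bij_betw (inner_map X x) (carrier X) (carrier X)"
    by (rule bij_betw_cong[THEN iffD1, rotated]) (simp add: inner_map_def)
  then show ?thesis by (simp add: BijGroup_def Bij_def inner_map_def)
qed

lemma (in quandle) inner_map_hom:
  assumes "x \<in> carrier X" shows "inner_map X x \<in> quandle_hom X X"
  using assms closed by (auto simp: quandle_hom_def inner_map_def intro: self_distrib)

lemma (in quandle) carrier_Inn:
  "carrier (Inn X) = generate (BijGroup (carrier X)) (inner_map X ` carrier X)"
proof -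
  have "carrier (BijGroup (carrier X)) \<inter> inner_map X ` carrier X = inner_map X ` carrier X"
    using inner_map_Bij by blast
  then show ?thesis by (simp add: Inn_def carrier_subgroup_generated)
qed

lemma quandle_separating_nat:
  fixes F :: "('b, 'c) quandle_scheme"
  assumes F: "quandle F" and fin: "finite (carrier F)" and hom: "\<phi> \<in> quandle_hom X F"
    and x: "x \<in> carrier X" and y: "y \<in> carrier X" and neq: "\<phi> x \<noteq> \<phi> y"
  shows "\<exists>(F' :: nat quandle) \<psi>. quandle F' \<and> finite (carrier F') \<and> \<psi> \<in> quandle_hom X F' \<and> \<psi> x \<noteq> \<psi> y"
proof -
  interpret F: quandle F by fact
  obtain e :: "'b \<Rightarrow> nat" where inj: "inj_on e (carrier F)"
    using finite_imp_inj_to_nat_seg[OF fin] by blast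
  define d where "d = inv_into (carrier F) e"
  have d[simp]: "d (e a) = a" if "a \<in> carrier F" for a
    using inj that by (simp add: d_def)
  have e_eq: "e a = e b \<longleftrightarrow> a = b" if "a \<in> carrier F" "b \<in> carrier F" for a b
    using inj that by (auto simp: inj_on_def)
  define F' where "F' = \<lparr>carrier = e ` carrier F, quandle_op = \<lambda>m n. e (d m \<triangleright>\<^bsub>F\<^esub> d n)\<rparr>"
  have "quandle F'"
  proof
    fix m n assume "m \<in> carrier F'" "n \<in> carrier F'"
    then obtain a b where ab: "a \<in> carrier F" "b \<in> carrier F" "m = e a" "n = e b"
      by (auto simp: F'_def)
    obtain c where c: "c \<in> carrier F" "a = c \<triangleright>\<^bsub>F\<^esub> b"
      and uniq: "\<And>c'. c' \<in> carrier F \<Longrightarrow> a = c' \<triangleright>\<^bsub>F\<^esub> b \<Longrightarrow> c' = c"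
      using F.right_div[OF ab(1,2)] by metis
    show "\<exists>!k. k \<in> carrier F' \<and> m = k \<triangleright>\<^bsub>F'\<^esub> n"
    proof (rule ex1I[of _ "e c"])
      show "e c \<in> carrier F' \<and> m = e c \<triangleright>\<^bsub>F'\<^esub> n"
        using c ab by (simp add: F'_def)
    next
      fix k assume k: "k \<in> carrier F' \<and> m = k \<triangleright>\<^bsub>F'\<^esub> n"
      then obtain c' where c': "c' \<in> carrier F" "k = e c'" by (auto simp: F'_def)
      with k ab have "a = c' \<triangleright>\<^bsub>F\<^esub> b" by (simp add: F'_def e_eq F.closed)
      with c' uniq show "k = e c" by simp
    qed
  next
    fix m n k assume "m \<in> carrier F'" "n \<in> carrier F'" "k \<in> carrier F'"
    then obtain a b c where "a \<in> carrier F" "b \<in> carrier F" "c \<in> carrier F" "m = e a" "n = e b" "k = e c"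
      by (auto simp: F'_def)
    then show "(m \<triangleright>\<^bsub>F'\<^esub> n) \<triangleright>\<^bsub>F'\<^esub> k = (m \<triangleright>\<^bsub>F'\<^esub> k) \<triangleright>\<^bsub>F'\<^esub> (n \<triangleright>\<^bsub>F'\<^esub> k)"
      using F.self_distrib[of a b c] by (simp add: F'_def F.closed)
  qed (auto simp: F'_def F.nonempty F.closed F.idem)
  moreover have "finite (carrier F')" by (simp add: F'_def fin)
  moreover have "e \<circ> \<phi> \<in> quandle_hom X F'"
    using hom by (auto simp: quandle_hom_def F'_def Pi_iff)
  moreover have "(e \<circ> \<phi>) x \<noteq> (e \<circ> \<phi>) y"
    using hom x y neq by (auto simp: quandle_hom_def e_eq Pi_iff)
  ultimately show ?thesis by blast
qed

lemma group_separating_nat: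
  fixes F :: "('b, 'c) monoid_scheme"
  assumes F: "group F" and fin: "finite (carrier F)" and hom: "\<phi> \<in> hom G F"
    and g: "g \<in> carrier G" and neq: "\<phi> g \<noteq> \<one>\<^bsub>F\<^esub>"
  shows "\<exists>(F' :: nat monoid) \<psi>. group F' \<and> finite (carrier F') \<and> \<psi> \<in> hom G F' \<and> \<psi> g \<noteq> \<one>\<^bsub>F'\<^esub>"
proof -
  interpret F: group F by fact
  obtain e :: "'b \<Rightarrow> nat" where inj: "inj_on e (carrier F)"
    using finite_imp_inj_to_nat_seg[OF fin] by blast
  define d where "d = inv_into (carrier F) e"
  have d[simp]: "d (e a) = a" if "a \<in> carrier F" for a
    using inj that by (simp add: d_def)
  have e_eq: "e a = e b \<longleftrightarrow> a = b" if "a \<in> carrier F" "b \<in> carrier F" for a b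
    using inj that by (auto simp: inj_on_def)
  define F' where
    "F' = \<lparr>carrier = e ` carrier F, mult = \<lambda>m n. e (d m \<otimes>\<^bsub>F\<^esub> d n), one = e \<one>\<^bsub>F\<^esub>\<rparr>"
  have "group F'"
  proof (rule groupI)
    fix m assume "m \<in> carrier F'"
    then obtain a where "a \<in> carrier F" "m = e a" by (auto simp: F'_def)
    then show "\<exists>k\<in>carrier F'. k \<otimes>\<^bsub>F'\<^esub> m = \<one>\<^bsub>F'\<^esub>"
      by (intro bexI[of _ "e (inv\<^bsub>F\<^esub> a)"]) (auto simp: F'_def)
  qed (auto simp: F'_def F.m_assoc)
  moreover have "finite (carrier F')" by (simp add: F'_def fin)
  moreover have "e \<circ> \<phi> \<in> hom G F'"
    using hom by (auto simp: hom_def F'_def Pi_iff)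
  moreover have "(e \<circ> \<phi>) g \<noteq> \<one>\<^bsub>F'\<^esub>"
    using hom g neq by (auto simp: hom_def F'_def e_eq Pi_iff)
  ultimately show ?thesis by blast
qed

end

theory Submission
  imports Defs
begin

text \<open>Every element of \<open>Inn X\<close> permutes the fibres of a quandle homomorphism \<open>\<phi>: X \<rightarrow> F\<close>: the
  generators do, because right translations of \<open>F\<close> are injective, and the bijections permuting the
  fibres form a group. Hence \<open>Inn X\<close> acts on \<open>\<phi>(X)\<close>, and for finite \<open>F\<close> this action is a homomorphism
  into a finite group. If \<open>g\<close> moves \<open>x\<close> and \<open>\<phi>\<close> separates \<open>g(x)\<close> from \<open>x\<close>, then \<open>g\<close> acts nontrivially.\<close>

definition fibre_perms :: "('a \<Rightarrow> 'b) \<Rightarrow> 'a set \<Rightarrow> ('a \<Rightarrow> 'a) set"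
  where "fibre_perms f S = {g \<in> Bij S. \<forall>x\<in>S. \<forall>y\<in>S. f (g x) = f (g y) \<longleftrightarrow> f x = f y}"

text \<open>\<open>inv_into\<close> picks one point of each fibre; for \<open>g\<close> in
  \<open>fibre_perms f S\<close> the value does not depend on this choice. The restriction gives the
  extensionality that \<open>Bij\<close> demands.\<close>

definition descend :: "('a \<Rightarrow> 'b) \<Rightarrow> 'a set \<Rightarrow> ('a \<Rightarrow> 'a) \<Rightarrow> 'b \<Rightarrow> 'b"
  where "descend f S g = (\<lambda>t\<in>f ` S. f (g (inv_into S f t)))"

lemma carrier_BijGroup: "carrier (BijGroup S) = Bij S"
  by (simp add: BijGroup_def)

lemma one_BijGroup: "\<one>\<^bsub>BijGroup S\<^esub> = (\<lambda>x\<in>S. x)"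
  by (simp add: BijGroup_def)

lemma mult_BijGroup: "g \<in> Bij S \<Longrightarrow> h \<in> Bij S \<Longrightarrow> g \<otimes>\<^bsub>BijGroup S\<^esub> h = compose S g h"
  by (simp add: BijGroup_def)

lemma Bij_mem: "g \<in> Bij S \<Longrightarrow> x \<in> S \<Longrightarrow> g x \<in> S"
  using Bij_imp_funcset by blast

lemma finite_Bij:
  assumes "finite S" shows "finite (Bij S)"
proof (rule finite_subset)
  show "Bij S \<subseteq> S \<rightarrow>\<^sub>E S" by (auto simp: PiE_def Bij_mem Bij_imp_extensional)
  show "finite (S \<rightarrow>\<^sub>E S)" using assms by (simp add: finite_PiE)
qed

lemma subgroup_fibre_perms: "subgroup (fibre_perms f S) (BijGroup S)"
proof -
  interpret B: group "BijGroup S" by (rule group_BijGroup)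
  show ?thesis
  proof (rule B.subgroupI)
    show "fibre_perms f S \<subseteq> carrier (BijGroup S)"
      by (auto simp: fibre_perms_def carrier_BijGroup)
    have "(\<lambda>x\<in>S. x) \<in> fibre_perms f S"
      by (simp add: fibre_perms_def id_Bij)
    then show "fibre_perms f S \<noteq> {}" by blast
  next
    fix g assume "g \<in> fibre_perms f S"
    then have g: "g \<in> Bij S" and fib: "\<And>x y. x \<in> S \<Longrightarrow> y \<in> S \<Longrightarrow> f (g x) = f (g y) \<longleftrightarrow> f x = f y"
      by (auto simp: fibre_perms_def)
    have surj: "g ` S = S" using g by (simp add: Bij_def bij_betw_def)
    \<comment> \<open>Since \<open>g\<close> is onto, the fibre condition for \<open>g\<close> at
      the preimages of two points, read backwards, is the condition for the inverse at these
      points.\<close>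
    have "inv_into S g x \<in> S \<and> g (inv_into S g x) = x" if "x \<in> S" for x
      using that surj by (metis f_inv_into_f inv_into_into)
    then have "f (inv_into S g x) = f (inv_into S g y) \<longleftrightarrow> f x = f y" if "x \<in> S" "y \<in> S" for x y
      using fib[of "inv_into S g x" "inv_into S g y"] that by simp
    then show "inv\<^bsub>BijGroup S\<^esub> g \<in> fibre_perms f S"
      using g by (simp add: inv_BijGroup fibre_perms_def restrict_inv_into_Bij)
  next
    fix g h assume "g \<in> fibre_perms f S" "h \<in> fibre_perms f S"
    then show "g \<otimes>\<^bsub>BijGroup S\<^esub> h \<in> fibre_perms f S"
      by (auto simp: fibre_perms_def mult_BijGroup compose_Bij compose_eq Bij_mem)
  qed
qed

lemma descend_image:
  assumes g: "g \<in> fibre_perms f S" and x: "x \<in> S"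
  shows "descend f S g (f x) = f (g x)"
proof -
  have "inv_into S f (f x) \<in> S" "f (inv_into S f (f x)) = f x"
    using x by (auto intro: inv_into_into f_inv_into_f)
  then show ?thesis using g x by (simp add: descend_def fibre_perms_def)
qed

lemma descend_Bij:
  assumes g: "g \<in> fibre_perms f S"
  shows "descend f S g \<in> Bij (f ` S)"
proof -
  have gB: "g \<in> Bij S" using g by (simp add: fibre_perms_def)
  have "inj_on (descend f S g) (f ` S)"
    using g by (auto simp: inj_on_def descend_image) (simp add: fibre_perms_def)
  moreover have "descend f S g ` f ` S = f ` g ` S"
    using g by (simp add: image_image descend_image)
  moreover have "g ` S = S" using gB by (simp add: Bij_def bij_betw_def)
  ultimately have "bij_betw (descend f S g) (f ` S) (f ` S)"
    by (simp add: bij_betw_def)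
  then show ?thesis by (simp add: Bij_def descend_def)
qed

text \<open>Both sides are extensional and send \<open>f x\<close> to
  \<open>f (g (h x))\<close>.\<close>

lemma descend_compose:
  assumes g: "g \<in> fibre_perms f S" and h: "h \<in> fibre_perms f S"
  shows "descend f S (compose S g h) = compose (f ` S) (descend f S g) (descend f S h)"
proof -
  have gB: "g \<in> Bij S" and hB: "h \<in> Bij S"
    using g h by (simp_all add: fibre_perms_def)
  have gh: "compose S g h \<in> fibre_perms f S"
    using subgroup.m_closed[OF subgroup_fibre_perms g h] mult_BijGroup[OF gB hB] by simp
  show ?thesis
  proof (rule extensionalityI[of _ "f ` S"])
    show "descend f S (compose S g h) \<in> extensional (f ` S)" by (simp add: descend_def)
    show "compose (f ` S) (descend f S g) (descend f S h) \<in> extensional (f ` S)"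
      by (rule compose_extensional)
  next
    fix t assume "t \<in> f ` S"
    then show "descend f S (compose S g h) t = compose (f ` S) (descend f S g) (descend f S h) t"
      using g h gh hB by (auto simp: compose_eq descend_image Bij_mem)
  qed
qed

context quandle
begin

lemma right_cancel:
  assumes "x \<in> carrier X" "y \<in> carrier X" "z \<in> carrier X"
  shows "x \<triangleright> z = y \<triangleright> z \<longleftrightarrow> x = y"
  using assms right_div[of "x \<triangleright> z" z] closed by metis

lemma group_Inn: "group (Inn X)"
  unfolding Inn_def by (rule group.group_subgroup_generated[OF group_BijGroup])

lemma carrier_Inn_subset: "carrier (Inn X) \<subseteq> Bij (carrier X)"
  unfolding Inn_def carrier_BijGroup[symmetric]
  by (rule group.carrier_subgroup_generated_subset[OF group_BijGroup])

text \<open>A generator sends \<open>x\<close> to a point with image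
  \<open>\<phi> x \<triangleright> \<phi> a\<close> in \<open>F\<close>, and cancelling
  \<open>\<phi> a\<close> there is exactly the fibre condition. As \<open>fibre_perms\<close> is a
  subgroup, it contains all that the generators generate.\<close>

lemma Inn_subset_fibre_perms:
  assumes F: "quandle F" and hom: "\<phi> \<in> quandle_hom X F"
  shows "carrier (Inn X) \<subseteq> fibre_perms \<phi> (carrier X)"
proof -
  interpret F: quandle F by fact
  have mem: "\<phi> x \<in> carrier F" if "x \<in> carrier X" for x
    using hom that by (auto simp: quandle_hom_def)
  have op: "\<phi> (x \<triangleright> y) = \<phi> x \<triangleright>\<^bsub>F\<^esub> \<phi> y" if "x \<in> carrier X" "y \<in> carrier X" for x y
    using hom that by (simp add: quandle_hom_def)
  have "inner_map X a \<in> fibre_perms \<phi> (carrier X)" if a: "a \<in> carrier X" for a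
    using inner_map_Bij[OF a] a
    by (simp add: fibre_perms_def carrier_BijGroup inner_map_def op F.right_cancel mem)
  then show ?thesis
    unfolding carrier_Inn
    by (intro group.generate_subgroup_incl[OF group_BijGroup _ subgroup_fibre_perms]) auto
qed

text \<open>The target permutes the image of \<open>\<phi>\<close> and not all of \<open>F\<close>,
  since \<open>g\<close> determines nothing outside the image.\<close>

lemma descend_hom:
  assumes "quandle F" "\<phi> \<in> quandle_hom X F"
  shows "descend \<phi> (carrier X) \<in> hom (Inn X) (BijGroup (\<phi> ` carrier X))"
proof (rule homI)
  fix g assume "g \<in> carrier (Inn X)"
  then show "descend \<phi> (carrier X) g \<in> carrier (BijGroup (\<phi> ` carrier X))"
    using Inn_subset_fibre_perms[OF assms] descend_Bij by (auto simp: carrier_BijGroup)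
next
  fix g h assume gh: "g \<in> carrier (Inn X)" "h \<in> carrier (Inn X)"
  then have fib: "g \<in> fibre_perms \<phi> (carrier X)" "h \<in> fibre_perms \<phi> (carrier X)"
    using Inn_subset_fibre_perms[OF assms] by auto
  have "g \<otimes>\<^bsub>Inn X\<^esub> h = compose (carrier X) g h"
    using mult_BijGroup[of g "carrier X" h] gh carrier_Inn_subset by (auto simp: Inn_def)
  then show "descend \<phi> (carrier X) (g \<otimes>\<^bsub>Inn X\<^esub> h)
      = descend \<phi> (carrier X) g \<otimes>\<^bsub>BijGroup (\<phi> ` carrier X)\<^esub> descend \<phi> (carrier X) h"
    using fib by (simp add: descend_compose mult_BijGroup descend_Bij)
qed

end

theorem theorem4p3:
  fixes X :: "('a, 'b) quandle_scheme"
  assumes "residually_finite_quandle X"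
  shows "residually_finite_group (Inn X)"
proof -
  interpret residually_finite_quandle X by fact
  show ?thesis
  proof (rule residually_finite_group.intro[OF group_Inn], unfold_locales)
    fix g assume g: "g \<in> carrier (Inn X)" and neq: "g \<noteq> \<one>\<^bsub>Inn X\<^esub>"
    have gB: "g \<in> Bij (carrier X)" using g carrier_Inn_subset by blast
    have "g \<noteq> (\<lambda>x\<in>carrier X. x)" using neq by (simp add: Inn_def one_BijGroup)
    \<comment> \<open>Elements of \<open>Bij\<close> are extensional, so a non-identity one moves a
      point of the carrier.\<close>
    then obtain x where x: "x \<in> carrier X" and gx: "g x \<noteq> x"
      using extensionalityI[OF Bij_imp_extensional[OF gB] restrict_extensional] by force
    obtain F :: "nat quandle" and \<phi> where F: "quandle F" "\<phi> \<in> quandle_hom X F"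
      and fin: "finite (carrier F)" and sep: "\<phi> (g x) \<noteq> \<phi> x"
      using separating[OF Bij_mem[OF gB x] x gx] by blast
    let ?B = "BijGroup (\<phi> ` carrier X)"
    have "\<phi> ` carrier X \<subseteq> carrier F" using F(2) by (auto simp: quandle_hom_def)
    then have finB: "finite (carrier ?B)"
      unfolding carrier_BijGroup by (intro finite_Bij finite_subset[OF _ fin])
    \<comment> \<open>The induced permutation moves \<open>\<phi> x\<close>, because
      \<open>\<phi>\<close> separates \<open>g x\<close> from \<open>x\<close>.\<close>
    have "descend \<phi> (carrier X) g (\<phi> x) = \<phi> (g x)"
      using g x Inn_subset_fibre_perms[OF F] by (intro descend_image) auto
    then have "descend \<phi> (carrier X) g \<noteq> \<one>\<^bsub>?B\<^esub>"
      using sep x by (auto simp: one_BijGroup)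
    \<comment> \<open>The permutation group consists of functions on \<open>nat\<close>; it is
      replaced by an isomorphic copy with carrier in \<open>nat\<close>.\<close>
    then show "\<exists>(F :: nat monoid) \<psi>. group F \<and> finite (carrier F) \<and> \<psi> \<in> hom (Inn X) F \<and> \<psi> g \<noteq> \<one>\<^bsub>F\<^esub>"
      by (rule group_separating_nat[OF group_BijGroup finB descend_hom[OF F] g])
  qed
qed

end
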